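(* The approximation ratio of root rounding is at least $\frac{62}{53}$: there exist a tree topology $U$, a frequency vector $f$, an optimal solution $P$ of the STT LP for $U$ with objective $f$, and a sequence of root choices permitted by root rounding applied to $P$, such that the resulting STT $T$ satisfies $\mathrm{cost}(T,f)\ge\frac{62}{53}\min_{T'}\mathrm{cost}(T',f)$, the minimum being over all STTs $T'$ over $U$.
   Context: For a tree $U$ (also denoting its node set) and distinct nodes $i,j$, let $(i\leftrightsquigarrow j)$ denote the set of nodes strictly between $i$ and $j$ on the unique $U$-path, and $[u\leftrightsquigarrow v)$ the path including $u$ but excluding $v$. An STT $T$ over $U$ is defined recursively: pick a node $r$ as root; the subtrees of $r$ are STTs built recursively over the connected components of $U\setminus\{r\}$. The depth of a node in $T$ is the number of nodes on its path to the root inclusive (root has depth $1$); for a nonnegative frequency vector $f$ summing to $1$, $\mathrm{cost}(T,f)=\sum_v f_v\,\mathrm{depth}_T(v)$. The STT LP for $U$ has variables $D_i$, $X_{ij}$ ($i\ne j$), $Z_{kij}=Z_{kji}$ ($k\in(i\leftrightsquigarrow j)$); constraints $X,Z\ge0$; $X_{ij}+X_{ji}+\sum_{k\in(i\leftrightsquigarrow j)}Z_{kij}\ge1$ for all $i\ne j$; $Z_{kij}\le X_{ki}$, $Z_{kij}\le X_{kj}$; $D_i\ge\sum_{j\ne i}X_{ji}$; objective minimize $\sum_i f_iD_i$. Root rounding of a feasible point $P=(X,Z,D)$ over a (sub)tree $H$: if $H$ is a single node, return it; otherwise choose any node $r\in H$ such that for every $v\in H\setminus\{r\}$, $\sum_{u\in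 H:\ r\in[u\leftrightsquigarrow v)}X_{uv}\ge\frac12$ (such $r$ always exists), make $r$ the root, and recursively root-round $P$ over each connected component of $H\setminus\{r\}$ to form the subtrees of $r$. *)

theory Defs
  imports Complex_Main "HOL-Library.FSet"
begin

section \<open>Trees and paths\<close>

text \<open>A finite simple graph is given by its node set and a set of two-element node sets.\<close>

definition adj_in :: "'a set set \<Rightarrow> 'a set \<Rightarrow> ('a \<times> 'a) set" where
  "adj_in E S = {(a, b). a \<in> S \<and> b \<in> S \<and> {a, b} \<in> E}"

definition components :: "'a set set \<Rightarrow> 'a set \<Rightarrow> 'a set set" where
  "components E S = (\<lambda>u. {v \<in> S. (u, v) \<in> (adj_in E S)\<^sup>*}) ` S"

definition is_cycle :: "'a set set \<Rightarrow> 'a list \<Rightarrow> bool" where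
  "is_cycle E p \<longleftrightarrow> length p \<ge> 3 \<and> distinct p \<and>
     successively (\<lambda>a b. {a, b} \<in> E) p \<and> {last p, hd p} \<in> E"

definition is_tree :: "'a set \<Rightarrow> 'a set set \<Rightarrow> bool" where
  "is_tree V E \<longleftrightarrow> finite V \<and> V \<noteq> {} \<and>
     (\<forall>e\<in>E. e \<subseteq> V \<and> card e = 2) \<and>
     (\<forall>u\<in>V. \<forall>v\<in>V. (u, v) \<in> (adj_in E V)\<^sup>*) \<and>
     (\<nexists>p. is_cycle E p)"

definition is_path :: "'a set set \<Rightarrow> 'a \<Rightarrow> 'a \<Rightarrow> 'a list \<Rightarrow> bool" where
  "is_path E u v p \<longleftrightarrow> p \<noteq> [] \<and> hd p = u \<and> last p = v \<and> distinct p \<and>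
     successively (\<lambda>a b. {a, b} \<in> E) p"

definition path_nodes :: "'a set set \<Rightarrow> 'a \<Rightarrow> 'a \<Rightarrow> 'a set" where
  "path_nodes E u v = set (THE p. is_path E u v p)"

definition strictly_between :: "'a set set \<Rightarrow> 'a \<Rightarrow> 'a \<Rightarrow> 'a set" where
  "strictly_between E i j = path_nodes E i j - {i, j}"

definition path_excl_end :: "'a set set \<Rightarrow> 'a \<Rightarrow> 'a \<Rightarrow> 'a set" where
  "path_excl_end E u v = path_nodes E u v - {v}"


section \<open>Search trees on trees\<close>

datatype 'a rtree = Node 'a "'a rtree fset"

text \<open>In the rule below \<open>S\<close> assigns to each connected component the subtree built over it.\<close>

inductive is_stt :: "'a set set \<Rightarrow> 'a set \<Rightarrow> 'a rtree \<Rightarrow> bool" for E where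
  "r \<in> H \<Longrightarrow>
   (\<And>C. C \<in> components E (H - {r}) \<Longrightarrow> is_stt E C (S C)) \<Longrightarrow>
   fset ts = S ` components E (H - {r}) \<Longrightarrow>
   is_stt E H (Node r ts)"

inductive root_path :: "'a rtree \<Rightarrow> 'a \<Rightarrow> 'a list \<Rightarrow> bool" where
  "root_path (Node r ts) r [r]"
| "t |\<in>| ts \<Longrightarrow> root_path t v p \<Longrightarrow> root_path (Node r ts) v (r # p)"

definition depth :: "'a rtree \<Rightarrow> 'a \<Rightarrow> nat" where
  "depth T v = length (THE p. root_path T v p)"

definition is_frequency :: "'a set \<Rightarrow> ('a \<Rightarrow> real) \<Rightarrow> bool" where
  "is_frequency V f \<longleftrightarrow> (\<forall>v\<in>V. f v \<ge> 0) \<and> (\<Sum>v\<in>V. f v) = 1"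

definition stt_cost :: "'a set \<Rightarrow> 'a rtree \<Rightarrow> ('a \<Rightarrow> real) \<Rightarrow> real" where
  "stt_cost V T f = (\<Sum>v\<in>V. f v * real (depth T v))"


text \<open>There are finitely many search trees, and at least one, so the minimum cost is attained.\<close>

lemma components_subset: "C \<in> components E S \<Longrightarrow> C \<subseteq> S"
  by (auto simp: components_def)

lemma components_nonempty: "C \<in> components E S \<Longrightarrow> C \<noteq> {}"
  by (auto simp: components_def)

lemma finite_components: "finite S \<Longrightarrow> finite (components E S)"
  by (simp add: components_def)

lemma finite_is_stt: "finite H \<Longrightarrow> finite {T. is_stt E H T}"
proof (induction H rule: finite_psubset_induct)
  case (psubset H)
  define A where "A r = (\<Union>C\<in>components E (H - {r}). {T. is_stt E C T})" for r
  have finA: "finite (A r)" if "r \<in> H" for r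
  proof -
    have "finite {T. is_stt E C T}" if "C \<in> components E (H - {r})" for C
      using psubset.IH components_subset[OF that] \<open>r \<in> H\<close> by blast
    then show ?thesis
      unfolding A_def using psubset.hyps by (intro finite_UN_I finite_components) auto
  qed
  have "finite (fset -` Pow (A r))" if "r \<in> H" for r
    using finA[OF that] by (intro finite_vimageI) (auto simp: inj_def fset_inject)
  then have "finite (\<Union>r\<in>H. Node r ` (fset -` Pow (A r)))"
    using psubset.hyps by blast
  moreover have "{T. is_stt E H T} \<subseteq> (\<Union>r\<in>H. Node r ` (fset -` Pow (A r)))"
  proof
    fix T assume "T \<in> {T. is_stt E H T}"
    then have "is_stt E H T" by simp
    then show "T \<in> (\<Union>r\<in>H. Node r ` (fset -` Pow (A r)))"
    proof cases
      case (1 r S ts)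
      then have "ts \<in> fset -` Pow (A r)" by (auto simp: A_def)
      with 1 show ?thesis by blast
    qed
  qed
  ultimately show ?case by (rule rev_finite_subset)
qed

lemma ex_is_stt: "finite H \<Longrightarrow> H \<noteq> {} \<Longrightarrow> \<exists>T. is_stt E H T"
proof (induction H rule: finite_psubset_induct)
  case (psubset H)
  then obtain r where r: "r \<in> H" by blast
  have "\<exists>T. is_stt E C T" if "C \<in> components E (H - {r})" for C
    using psubset.IH components_subset[OF that] components_nonempty[OF that] r by blast
  then obtain S where S: "\<And>C. C \<in> components E (H - {r}) \<Longrightarrow> is_stt E C (S C)" by metis
  have "finite (S ` components E (H - {r}))"
    using psubset.hyps by (simp add: finite_components)
  then have "fset (Abs_fset (S ` components E (H - {r}))) = S ` components E (H - {r})"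
    by (simp add: Abs_fset_inverse)
  with r S show ?case by (blast intro: is_stt.intros)
qed


section \<open>The linear program\<close>

record 'a lp_point =
  lpX :: "'a \<Rightarrow> 'a \<Rightarrow> real"
  lpZ :: "'a \<Rightarrow> 'a \<Rightarrow> 'a \<Rightarrow> real"
  lpD :: "'a \<Rightarrow> real"

text \<open>
  The variables of the program are the values \<open>lpD P i\<close>, \<open>lpX P i j\<close> with \<open>i \<noteq> j\<close>, and
  \<open>lpZ P k i j\<close> with \<open>k\<close> strictly between \<open>i\<close> and \<open>j\<close>, for nodes in \<open>V\<close>; values at other
  arguments are irrelevant. The identification of \<open>Z\<^bsub>kij\<^esub>\<close> with \<open>Z\<^bsub>kji\<^esub>\<close> is an equation.
\<close>

definition lp_feasible :: "'a set \<Rightarrow> 'a set set \<Rightarrow> 'a lp_point \<Rightarrow> bool" where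
  "lp_feasible V E P \<longleftrightarrow>
     (\<forall>i\<in>V. \<forall>j\<in>V. i \<noteq> j \<longrightarrow>
        lpX P i j \<ge> 0 \<and>
        lpX P i j + lpX P j i + (\<Sum>k\<in>strictly_between E i j. lpZ P k i j) \<ge> 1 \<and>
        (\<forall>k\<in>strictly_between E i j.
           lpZ P k i j \<ge> 0 \<and> lpZ P k i j = lpZ P k j i \<and>
           lpZ P k i j \<le> lpX P k i \<and> lpZ P k i j \<le> lpX P k j)) \<and>
     (\<forall>i\<in>V. lpD P i \<ge> (\<Sum>j\<in>V - {i}. lpX P j i))"

definition lp_objective :: "'a set \<Rightarrow> ('a \<Rightarrow> real) \<Rightarrow> 'a lp_point \<Rightarrow> real" where
  "lp_objective V f P = (\<Sum>i\<in>V. f i * lpD P i)"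

definition lp_optimal :: "'a set \<Rightarrow> 'a set set \<Rightarrow> ('a \<Rightarrow> real) \<Rightarrow> 'a lp_point \<Rightarrow> bool" where
  "lp_optimal V E f P \<longleftrightarrow> lp_feasible V E P \<and>
     (\<forall>Q. lp_feasible V E Q \<longrightarrow> lp_objective V f P \<le> lp_objective V f Q)"


section \<open>Root rounding\<close>

definition permitted_root :: "'a set set \<Rightarrow> 'a lp_point \<Rightarrow> 'a set \<Rightarrow> 'a \<Rightarrow> bool" where
  "permitted_root E P H r \<longleftrightarrow> r \<in> H \<and>
     (\<forall>v\<in>H - {r}. (\<Sum>u | u \<in> H \<and> r \<in> path_excl_end E u v. lpX P u v) \<ge> 1/2)"

text \<open>\<open>root_rounding E P H T\<close>: some sequence of permitted root choices over \<open>H\<close> results in \<open>T\<close>.\<close>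

inductive root_rounding :: "'a set set \<Rightarrow> 'a lp_point \<Rightarrow> 'a set \<Rightarrow> 'a rtree \<Rightarrow> bool" for E P where
  single: "root_rounding E P {v} (Node v {||})"
| split: "card H \<ge> 2 \<Longrightarrow> permitted_root E P H r \<Longrightarrow>
   (\<And>C. C \<in> components E (H - {r}) \<Longrightarrow> root_rounding E P C (S C)) \<Longrightarrow>
   fset ts = S ` components E (H - {r}) \<Longrightarrow>
   root_rounding E P H (Node r ts)"

end

theory Submission
  imports Defs
begin

text \<open>
  Take the path \<open>0 - 1 - 2\<close> with frequency \<open>1/2\<close> on both ends and \<open>0\<close> on the middle node.
  Since \<open>Z\<^bsub>102\<^esub> \<le> X\<^bsub>10\<^esub>\<close>, the covering constraint for the pair \<open>0, 2\<close> forces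
  \<open>D\<^bsub>0\<^esub> + D\<^bsub>2\<^esub> \<ge> 1\<close>, so the point with \<open>X\<^bsub>02\<^esub> = X\<^bsub>20\<^esub> = 1/2\<close> and \<open>X\<^bsub>01\<^esub> = X\<^bsub>21\<^esub> = 1\<close> is
  optimal. It permits the middle node as root, at cost \<open>2\<close>, whereas the search tree with the
  nodes \<open>0, 2, 1\<close> from the root downwards costs \<open>3/2\<close>. This gives the ratio \<open>4/3 \<ge> 62/53\<close>.
\<close>

definition path3 :: "nat set set" where
  "path3 = {{0, 1}, {1, 2}}"

lemma doubleton_in_path3_iff:
  "{a, b} \<in> path3 \<longleftrightarrow> (a, b) \<in> {(0, 1), (1, 0), (1, 2), (2, 1)}"
  by (auto simp: path3_def doubleton_eq_iff)

text \<open>Four distinct nodes cannot be successively adjacent in \<open>path3\<close>, so in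
  statements about its paths and cycles all longer lists collapse into one contradictory
  case.\<close>

lemma list_cases_up_to_3:
  obtains "p = []" | a where "p = [a]" | a b where "p = [a, b]" | a b c where "p = [a, b, c]"
  | a b c d q where "p = a # b # c # d # q"
  by (cases p; cases "tl p"; cases "tl (tl p)"; cases "tl (tl (tl p))"; simp)

lemma is_path_path3_iff:
  "is_path path3 u v p \<longleftrightarrow>
     p = [u] \<and> u = v \<or> p = [u, v] \<and> {u, v} \<in> path3 \<or>
     p = [u, 1, v] \<and> (u, v) \<in> {(0, 2), (2, 0)}"
  by (cases p rule: list_cases_up_to_3) (auto simp: is_path_def doubleton_in_path3_iff)

lemma path_nodes_path3:
  assumes "is_path path3 u v p"
  shows "path_nodes path3 u v = set p"
proof -
  have "(THE p. is_path path3 u v p) = p"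
    using assms by (intro the_equality) (auto simp: is_path_path3_iff doubleton_in_path3_iff)
  then show ?thesis by (simp add: path_nodes_def)
qed

lemma path_nodes_path3_simps:
  "path_nodes path3 u u = {u}"
  "path_nodes path3 0 1 = {0, 1}" "path_nodes path3 1 0 = {1, 0}"
  "path_nodes path3 1 2 = {1, 2}" "path_nodes path3 2 1 = {2, 1}"
  "path_nodes path3 0 2 = {0, 1, 2}" "path_nodes path3 2 0 = {2, 1, 0}"
  using path_nodes_path3[of u u "[u]"] path_nodes_path3[of 0 1 "[0, 1]"]
    path_nodes_path3[of 1 0 "[1, 0]"] path_nodes_path3[of 1 2 "[1, 2]"]
    path_nodes_path3[of 2 1 "[2, 1]"] path_nodes_path3[of 0 2 "[0, 1, 2]"]
    path_nodes_path3[of 2 0 "[2, 1, 0]"]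
  by (simp_all add: is_path_path3_iff doubleton_in_path3_iff)

lemma is_tree_path3: "is_tree {0, 1, 2} path3"
proof -
  have edge: "(a, b) \<in> adj_in path3 {0, 1, 2}" if "{a, b} \<in> path3" for a b
    using that by (auto simp: adj_in_def doubleton_in_path3_iff)
  have e: "(0, 1) \<in> adj_in path3 {0, 1, 2}" "(1, 0) \<in> adj_in path3 {0, 1, 2}"
    "(1, 2) \<in> adj_in path3 {0, 1, 2}" "(2, 1) \<in> adj_in path3 {0, 1, 2}"
    by (rule edge, simp add: doubleton_in_path3_iff)+
  have "(u, v) \<in> (adj_in path3 {0, 1, 2})\<^sup>*" if "u \<in> {0, 1, 2}" "v \<in> {0, 1, 2}" for u v
    using that e by (auto intro: rtrancl_trans[OF r_into_rtrancl r_into_rtrancl])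
  moreover have "\<not> is_cycle path3 p" for p
    \<comment> \<open>A simple path on three nodes has the ends 0 and 2, which are not adjacent, so
      it does not close up.\<close>
    by (cases p rule: list_cases_up_to_3) (auto simp: is_cycle_def doubleton_in_path3_iff)
  ultimately show ?thesis
    by (auto simp: is_tree_def path3_def)
qed

lemma components_empty: "components E {} = {}"
  by (simp add: components_def)

lemma components_singleton: "components E {v} = {{v}}"
  by (auto simp: components_def)

lemma components_edge: "{u, v} \<in> E \<Longrightarrow> components E {u, v} = {{u, v}}"
  by (auto simp: components_def adj_in_def insert_commute)

lemma components_no_edges: "adj_in E S = {} \<Longrightarrow> components E S = (\<lambda>v. {v}) ` S"
  by (auto simp: components_def)

lemma components_path3_ends: "components path3 {0, 2} = {{0}, {2}}"
proof -
  have "adj_in path3 {0, 2} = {}"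
    by (auto simp: adj_in_def doubleton_in_path3_iff)
  then show ?thesis by (simp add: components_no_edges)
qed

text \<open>Used as a rewrite rule, this unfolds the root paths of a concrete tree into explicit
  lists, which settles the \<open>THE\<close> in \<open>depth\<close>.\<close>

lemma root_path_Node_iff:
  "root_path (Node r ts) v p \<longleftrightarrow>
     v = r \<and> p = [r] \<or> (\<exists>t q. t |\<in>| ts \<and> root_path t v q \<and> p = r # q)"
  by (subst root_path.simps) auto

text \<open>Serves chain-shaped search trees, where removing the root leaves a connected
  rest.\<close>

lemma is_stt_one_component:
  assumes "r \<in> H" "components E (H - {r}) = {C}" "is_stt E C t"
  shows "is_stt E H (Node r {|t|})"
  using assms by (intro is_stt.intros[where S = "\<lambda>_. t"]) auto

lemma is_stt_singleton: "is_stt E {v} (Node v {||})"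
  by (intro is_stt.intros) (auto simp: components_empty)

text \<open>The value 2 of \<open>lpD\<close> at node 1 is the sum of its two incoming
  \<open>lpX\<close> values; it adds nothing to the objective because node 1 has frequency
  0.\<close>

definition lp_pt :: "nat lp_point" where
  "lp_pt = \<lparr>lpX = (\<lambda>i j. if i = 1 then 0 else if j = 1 then 1 else 1/2),
           lpZ = (\<lambda>_ _ _. 0),
           lpD = (\<lambda>i. if i = 1 then 2 else 1/2)\<rparr>"

definition ends_freq :: "nat \<Rightarrow> real" where
  "ends_freq i = (if i = 1 then 0 else 1/2)"

text \<open>\<open>lpX i j + lpX j i = 1\<close> for every pair, so each covering constraint already
  holds with \<open>lpZ\<close> equal to 0.\<close>

lemma lp_feasible_lp_pt: "lp_feasible {0, 1, 2} path3 lp_pt"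
proof -
  have "{0, 1, 2} - {0} = {1, 2 :: nat}" "{0, 1, 2} - {1} = {0, 2 :: nat}"
    "{0, 1, 2} - {2} = {0, 1 :: nat}"
    by auto
  then show ?thesis
    unfolding lp_feasible_def lp_pt_def by simp
qed

lemma lp_objective_ends:
  "lp_objective {0, 1, 2} ends_freq Q = (lpD Q 0 + lpD Q 2) / 2"
  by (simp add: lp_objective_def ends_freq_def)

lemma lp_optimal_lp_pt: "lp_optimal {0, 1, 2} path3 ends_freq lp_pt"
  unfolding lp_optimal_def
proof (intro conjI allI impI lp_feasible_lp_pt)
  fix Q assume Q: "lp_feasible {0, 1, 2} path3 Q"
  have sb: "strictly_between path3 0 2 = {1}"
    by (auto simp: strictly_between_def path_nodes_path3_simps)
  have "{0, 1, 2} - {0} = {1, 2 :: nat}" "{0, 1, 2} - {2} = {0, 1 :: nat}" by auto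
  then have D: "lpD Q 0 \<ge> lpX Q 1 0 + lpX Q 2 0" "lpD Q 2 \<ge> lpX Q 0 2 + lpX Q 1 2"
    using Q by (simp_all add: lp_feasible_def)
  have cover: "lpX Q 0 2 + lpX Q 2 0 + lpZ Q 1 0 2 \<ge> 1" and "lpZ Q 1 0 2 \<le> lpX Q 1 0"
    and "lpX Q 1 2 \<ge> 0"
    using Q sb by (auto simp: lp_feasible_def)
  \<comment> \<open>In the sum of the two bounds \<open>D\<close>, \<open>lpX Q 1 0\<close>
    dominates \<open>lpZ Q 1 0 2\<close> and \<open>lpX Q 1 2\<close> is dropped;
    \<open>cover\<close> bounds the rest.\<close>
  with D have "lpD Q 0 + lpD Q 2 \<ge> 1" by linarith
  then show "lp_objective {0, 1, 2} ends_freq lp_pt \<le> lp_objective {0, 1, 2} ends_freq Q"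
    unfolding lp_objective_ends by (simp add: lp_pt_def)
qed

text \<open>Both conditions are tight: node 1 contributes 0 and the opposite end contributes exactly
  1/2.\<close>

lemma permitted_root_middle: "permitted_root path3 lp_pt {0, 1, 2} 1"
proof -
  have sides: "{u. u \<in> {0, 1, 2} \<and> 1 \<in> path_excl_end path3 u 0} = {1, 2}"
    "{u. u \<in> {0, 1, 2} \<and> 1 \<in> path_excl_end path3 u 2} = {0, 1}"
    \<comment> \<open>Keeping \<open>1\<close> intact lets the equations for
      \<open>path_nodes\<close> match.\<close>
    by (auto simp: path_excl_end_def path_nodes_path3_simps simp del: One_nat_def)
  have "(\<Sum>u | u \<in> {0, 1, 2} \<and> 1 \<in> path_excl_end path3 u 0. lpX lp_pt u 0) \<ge> 1/2"
    "(\<Sum>u | u \<in> {0, 1, 2} \<and> 1 \<in> path_excl_end path3 u 2. lpX lp_pt u 2) \<ge> 1/2"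
    unfolding sides by (simp_all add: lp_pt_def)
  then show ?thesis
    unfolding permitted_root_def by blast
qed

lemma root_rounding_middle:
  "root_rounding path3 lp_pt {0, 1, 2} (Node 1 {|Node 0 {||}, Node 2 {||}|})"
proof (rule root_rounding.split[where S = "\<lambda>C. Node (the_elem C) {||}"])
  have comps: "components path3 ({0, 1, 2} - {1}) = {{0}, {2}}"
    using components_path3_ends by (simp add: insert_Diff_if)
  show "root_rounding path3 lp_pt C (Node (the_elem C) {||})"
    if "C \<in> components path3 ({0, 1, 2} - {1})" for C
    using that[unfolded comps] by (auto intro: root_rounding.single)
  show "fset {|Node 0 {||}, Node 2 {||}|} =
      (\<lambda>C. Node (the_elem C) {||}) ` components path3 ({0, 1, 2} - {1})"
    by (simp only: comps) simp
qed (use permitted_root_middle in auto)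

lemma is_stt_end_first: "is_stt path3 {0, 1, 2} (Node 0 {|Node 2 {|Node 1 {||}|}|})"
proof (rule is_stt_one_component)
  have "{0, 1, 2} - {0} = {1, 2 :: nat}" by auto
  then show "components path3 ({0, 1, 2} - {0}) = {{1, 2}}"
    by (simp add: components_edge doubleton_in_path3_iff)
  have "{1, 2} - {2} = {1 :: nat}" by auto
  then show "is_stt path3 {1, 2} (Node 2 {|Node 1 {||}|})"
    by (intro is_stt_one_component[OF _ _ is_stt_singleton]) (auto simp: components_singleton)
qed auto

lemma stt_cost_middle:
  "stt_cost {0, 1, 2} (Node 1 {|Node 0 {||}, Node 2 {||}|}) ends_freq = 2"
  \<comment> \<open>The root has two children, so the existential over subtrees must be split into
    its two cases.\<close>
  by (simp add: stt_cost_def ends_freq_def depth_def root_path_Node_iff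
      conj_disj_distribR ex_disj_distrib)

lemma stt_cost_end_first:
  "stt_cost {0, 1, 2} (Node 0 {|Node 2 {|Node 1 {||}|}|}) ends_freq = 3 / 2"
  by (simp add: stt_cost_def ends_freq_def depth_def root_path_Node_iff)

theorem theorem2p9:
  "\<exists>(V :: nat set) (E :: nat set set) (f :: nat \<Rightarrow> real) (P :: nat lp_point) (T :: nat rtree).
     is_tree V E \<and> is_frequency V f \<and> lp_optimal V E f P \<and> root_rounding E P V T \<and>
     stt_cost V T f \<ge> 62 / 53 * Min ((\<lambda>T'. stt_cost V T' f) ` {T'. is_stt E V T'})"
proof -
  let ?V = "{0, 1, 2 :: nat}"
  have "Min ((\<lambda>T'. stt_cost ?V T' ends_freq) ` {T'. is_stt path3 ?V T'}) \<le> 3 / 2"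
    using is_stt_end_first stt_cost_end_first
    by (intro Min_le finite_imageI finite_is_stt) (auto simp: image_iff)
  \<comment> \<open>Numerically, 62/53 * 3/2 = 93/53 < 2.\<close>
  then have "stt_cost ?V (Node 1 {|Node 0 {||}, Node 2 {||}|}) ends_freq
      \<ge> 62 / 53 * Min ((\<lambda>T'. stt_cost ?V T' ends_freq) ` {T'. is_stt path3 ?V T'})"
    unfolding stt_cost_middle by linarith
  moreover have "is_frequency ?V ends_freq"
    by (simp add: is_frequency_def ends_freq_def)
  ultimately show ?thesis
    using is_tree_path3 lp_optimal_lp_pt root_rounding_middle by blast
qed

end
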